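(* Let $T$ be an $n$-vertex tree, and let $\mathbf{s}\in\mathbb{Z}_{\ge0}^n$ be a self-reachable chip configuration on $T$. Then for any chip configuration $\mathbf{c}\in\mathbb{Z}_{\ge0}^n$ on $T$ with the same number of chips as $\mathbf{s}$ (i.e. $\sum_i c_i=\sum_i s_i$), one has $\mathbf{c}\in R^{(T)}(\mathbf{s})$ if and only if $\mathbf{c}$ is also self-reachable on $T$.
   Context: All graphs are finite and simple with at least one vertex; the vertices of an $n$-vertex graph are labelled $v_1,\dots,v_n$. A chip configuration on an $n$-vertex graph $G$ is a vector $\mathbf{c}\in\mathbb{Z}_{\ge 0}^n$, where $c_i$ is the number of chips on $v_i$. The Laplacian $\Delta(G)$ is the $n\times n$ matrix with $\Delta_{ii}=\deg(v_i)$, $\Delta_{ij}=-1$ if $i\ne j$ and $v_i,v_j$ are adjacent, and $\Delta_{ij}=0$ otherwise. Firing $v_i$ from $\mathbf{c}$ yields $\mathbf{c}-\Delta(G)\mathbf{e}_i$ (with $\mathbf{e}_i$ the $i$th standard basis vector); this is legal if $c_i\ge\deg(v_i)$, equivalently if the result is again a chip configuration (so firing a vertex of degree $0$ is always legal and changes nothing). A firing sequence is a finite sequence of vertex indices; it is legal on $G$ starting from $\mathbf{c}$ if, performing the firings in order starting from $\mathbf{c}$, each one is legal from the configuration reached so far. $R^{(G)}(\mathbf{c})$ denotes the set of chip configurations that can be reached from $\mathbf{c}$ by nonempty legal firing sequences on $G$. A chip configuration $\mathbf{s}$ on a connected graph $G$ is self-reachable on $G$ if $\mathbf{s}\in R^{(G)}(\mathbf{s})$.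 *)

theory Defs
  imports "Graph_Theory.Graph_Theory" "Jordan_Normal_Form.Matrix"
begin

text \<open>
  A simple graph is a \<^locale>\<open>pair_graph\<close>: a finite, loop-free, symmetric digraph whose arcs are
  pairs of vertices, so that each undirected edge is a pair of opposite arcs. The vertex
  $v_{i+1}$ of an $n$-vertex graph is the natural number $i$, and it is entry $i$ of vectors and
  matrices, which are indexed from 0.
\<close>

definition vertex_graph :: "nat \<Rightarrow> nat pair_pre_digraph \<Rightarrow> bool" where
  "vertex_graph n G \<longleftrightarrow> 1 \<le> n \<and> pair_graph G \<and> pverts G = {0..<n}"

text \<open>
  The predicate \<^const>\<open>tree\<close> of \<^theory>\<open>Graph_Theory.Digraph_Component\<close> does not describe undirected
  trees in this encoding: traversing an edge forth and back is a \<^const>\<open>pre_digraph.cycle\<close> of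
  length 2. Cycles of an undirected simple graph are the cycles of length at least 3.
\<close>

definition undirected_tree :: "nat pair_pre_digraph \<Rightarrow> bool" where
  "undirected_tree G \<longleftrightarrow>
     Digraph_Component.connected (with_proj G) \<and>
     \<not> (\<exists>p. pre_digraph.cycle (with_proj G) p \<and> 3 \<le> length p)"

definition vertex_tree :: "nat \<Rightarrow> nat pair_pre_digraph \<Rightarrow> bool" where
  "vertex_tree n T \<longleftrightarrow> vertex_graph n T \<and> undirected_tree T"

text \<open>By symmetry, the out-degree is the number of neighbours.\<close>

abbreviation deg :: "nat pair_pre_digraph \<Rightarrow> nat \<Rightarrow> nat" where
  "deg G i \<equiv> out_degree (with_proj G) i"

definition chip_config :: "nat \<Rightarrow> int vec \<Rightarrow> bool" where
  "chip_config n c \<longleftrightarrow> c \<in> carrier_vec n \<and> (\<forall>i<n. 0 \<le> c $ i)"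

definition laplacian :: "nat \<Rightarrow> nat pair_pre_digraph \<Rightarrow> int mat" where
  "laplacian n G = mat n n (\<lambda>(i, j).
     if i = j then int (deg G i) else if (i, j) \<in> parcs G then - 1 else 0)"

definition fire :: "nat \<Rightarrow> nat pair_pre_digraph \<Rightarrow> int vec \<Rightarrow> nat \<Rightarrow> int vec" where
  "fire n G c i = c - laplacian n G *\<^sub>v unit_vec n i"

definition legal_fire :: "nat \<Rightarrow> nat pair_pre_digraph \<Rightarrow> int vec \<Rightarrow> nat \<Rightarrow> bool" where
  "legal_fire n G c i \<longleftrightarrow> i < n \<and> int (deg G i) \<le> c $ i"

primrec legal_seq :: "nat \<Rightarrow> nat pair_pre_digraph \<Rightarrow> int vec \<Rightarrow> nat list \<Rightarrow> bool" where
  "legal_seq n G c [] \<longleftrightarrow> True"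
| "legal_seq n G c (i # is) \<longleftrightarrow> legal_fire n G c i \<and> legal_seq n G (fire n G c i) is"

definition fire_seq :: "nat \<Rightarrow> nat pair_pre_digraph \<Rightarrow> int vec \<Rightarrow> nat list \<Rightarrow> int vec" where
  "fire_seq n G c is = foldl (fire n G) c is"

definition reachable_configs :: "nat \<Rightarrow> nat pair_pre_digraph \<Rightarrow> int vec \<Rightarrow> int vec set" where
  "reachable_configs n G c =
     {d. chip_config n d \<and> (\<exists>is. is \<noteq> [] \<and> legal_seq n G c is \<and> fire_seq n G c is = d)}"

definition self_reachable :: "nat \<Rightarrow> nat pair_pre_digraph \<Rightarrow> int vec \<Rightarrow> bool" where
  "self_reachable n G s \<longleftrightarrow> chip_config n s \<and> s \<in> reachable_configs n G s"

end

theory Submission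
  imports Defs
begin

text \<open>
  Call a function \<open>r\<close> on the vertices a firing rank of a configuration \<open>c\<close> if every vertex \<open>v\<close>
  carries at least as many chips as it has neighbours \<open>u\<close> with \<open>r v \<le> r u\<close>. On a connected graph
  the self-reachable configurations are exactly those with a firing rank. In one direction, along a
  legal sequence from \<open>c\<close> back to \<open>c\<close> every vertex fires: an unfired vertex next to a fired one would
  only gain chips. Rank each vertex by the time of its last firing: after it has fired for the last
  time it still has a nonnegative number of chips, and since then it has received at least one chip from each
  neighbour that was last fired later (\<open>firing_rank_if_all_fire\<close>).

  The other direction comes from a greedy argument (\<open>legal_seq_to_ranked\<close>). Suppose that
  \<open>s = c + L x\<close> with \<open>L\<close> the Laplacian and \<open>x\<close> a vector of natural numbers, and that \<open>c\<close> has a firing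
  rank. Then the firings prescribed by \<open>x\<close> can be ordered legally from \<open>s\<close> to \<open>c\<close>: among the vertices
  where \<open>x\<close> is maximal, one of least rank can fire. With \<open>x = 1\<close>, so that \<open>L x = 0\<close>, the sequence
  leads from \<open>c\<close> to \<open>c\<close>.

  For the theorem, if \<open>c\<close> is reachable from a self-reachable \<open>s\<close>, a closed sequence at \<open>s\<close> followed by
  a sequence from \<open>s\<close> to \<open>c\<close> fires every vertex, so \<open>c\<close> has a firing rank. For the converse, the tree
  enters: cutting an edge \<open>uv\<close> splits the vertices into two sides, and \<open>L\<close> maps the indicator of the
  side of \<open>u\<close> to the difference of the unit vectors at \<open>u\<close> and \<open>v\<close>. Such differences generate all
  integer vectors with sum 0, so configurations with equally many chips differ by some \<open>L x\<close>
  (\<open>lap_surj_sum_zero\<close>). Adding a constant to \<open>x\<close> makes it nonnegative, and the greedy argument gives a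
  legal sequence from \<open>s\<close> to \<open>c\<close>.
\<close>

section \<open>Firing in terms of neighbourhoods\<close>

definition nbrs :: "nat pair_pre_digraph \<Rightarrow> nat \<Rightarrow> nat set" where
  "nbrs G i = {j. (i, j) \<in> parcs G}"

text \<open>
  The Laplacian as a difference operator on integer-valued functions: the net loss of chips at a
  vertex when each vertex \<open>j\<close> fires \<open>x j\<close> times.
\<close>

definition lap :: "nat pair_pre_digraph \<Rightarrow> (nat \<Rightarrow> int) \<Rightarrow> nat \<Rightarrow> int" where
  "lap G x i = (\<Sum>j\<in>nbrs G i. x i - x j)"

lemma lap_add: "lap G (\<lambda>i. x i + y i) i = lap G x i + lap G y i"
  unfolding lap_def by (simp add: sum.distrib[symmetric] algebra_simps)

lemma lap_scale: "lap G (\<lambda>i. a * x i) i = a * lap G x i"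
  unfolding lap_def by (simp add: sum_distrib_left algebra_simps)

lemma lap_const: "lap G (\<lambda>_. a) i = 0"
  unfolding lap_def by simp

lemma lap_sum: "lap G (\<lambda>i. \<Sum>k\<in>K. f k i) i = (\<Sum>k\<in>K. lap G (f k) i)"
  by (induction K rule: infinite_finite_induct) (simp_all add: lap_const lap_add)

lemma fire_seq_Nil [simp]: "fire_seq n G c [] = c"
  and fire_seq_Cons [simp]: "fire_seq n G c (i # is) = fire_seq n G (fire n G c i) is"
  and fire_seq_append: "fire_seq n G c (is @ js) = fire_seq n G (fire_seq n G c is) js"
  by (simp_all add: fire_seq_def)

lemma legal_seq_append:
  "legal_seq n G c (is @ js) \<longleftrightarrow> legal_seq n G c is \<and> legal_seq n G (fire_seq n G c is) js"
  by (induction "is" arbitrary: c) auto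

lemma legal_seq_imp_set: "legal_seq n G c is \<Longrightarrow> set is \<subseteq> {0..<n}"
  by (induction "is" arbitrary: c) (auto simp: legal_fire_def)

locale chip_graph =
  fixes n :: nat and T :: "nat pair_pre_digraph"
  assumes vertex_graph: "vertex_graph n T"
begin

lemma pair_graph: "pair_graph T" and n_pos: "0 < n" and pverts: "pverts T = {0..<n}"
  using vertex_graph by (auto simp: vertex_graph_def)

interpretation G: pair_graph T by (rule pair_graph)

lemma nbrs_subset: "nbrs T i \<subseteq> {0..<n}"
  using G.in_arcsD2 pverts by (auto simp: nbrs_def)

lemma finite_nbrs [simp]: "finite (nbrs T i)"
  using nbrs_subset finite_subset by blast

lemma nbrs_sym: "j \<in> nbrs T i \<longleftrightarrow> i \<in> nbrs T j"
  using G.pair_sym_arcs by (auto simp: nbrs_def symmetric_def sym_def)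

lemma not_nbrs_self [simp]: "i \<notin> nbrs T i"
  using G.pair_no_loops[of "(i, i)"] by (auto simp: nbrs_def)

lemma deg_eq: "deg T i = card (nbrs T i)"
proof -
  have "out_arcs (with_proj T) i = Pair i ` nbrs T i"
    by (auto simp: out_arcs_def nbrs_def)
  then show ?thesis
    by (simp add: out_degree_def card_image inj_on_def)
qed

lemma fire_index:
  assumes "i < n" "j < n"
  shows "fire n T c i $ j =
    c $ j - (if j = i then int (card (nbrs T i)) else if j \<in> nbrs T i then - 1 else 0)"
proof -
  have "(laplacian n T *\<^sub>v unit_vec n i) $ j = laplacian n T $$ (j, i)"
    using assms by (simp add: laplacian_def scalar_prod_right_unit)
  also have "\<dots> = (if j = i then int (card (nbrs T i)) else if j \<in> nbrs T i then - 1 else 0)"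
    using assms nbrs_sym[of i j] by (auto simp: laplacian_def deg_eq) (auto simp: nbrs_def)
  finally show ?thesis
    using assms by (simp add: fire_def laplacian_def)
qed

lemma dim_fire [simp]: "dim_vec (fire n T c i) = n"
  by (simp add: fire_def laplacian_def)

lemma chip_config_fire:
  assumes "chip_config n c" "legal_fire n T c i"
  shows "chip_config n (fire n T c i)"
  using assms
  by (auto simp: chip_config_def legal_fire_def fire_index deg_eq intro!: carrier_vecI)

lemma chip_config_fire_seq:
  "chip_config n c \<Longrightarrow> legal_seq n T c is \<Longrightarrow> chip_config n (fire_seq n T c is)"
  by (induction "is" arbitrary: c) (auto intro: chip_config_fire)

lemma reachable_iff:
  assumes "chip_config n c"
  shows "d \<in> reachable_configs n T c \<longleftrightarrow>
    (\<exists>is. is \<noteq> [] \<and> legal_seq n T c is \<and> fire_seq n T c is = d)"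
  using chip_config_fire_seq[OF assms] by (auto simp: reachable_configs_def)

section \<open>Firing ranks\<close>

definition firing_rank :: "int vec \<Rightarrow> (nat \<Rightarrow> nat) \<Rightarrow> bool" where
  "firing_rank c r \<longleftrightarrow> (\<forall>v<n. int (card {u \<in> nbrs T v. r v \<le> r u}) \<le> c $ v)"

text \<open>
  The rank is the position of the last firing. A vertex that fires now gets the highest rank, so
  that the bound for it is that its number of chips stays nonnegative; each neighbour that fired
  before gains one chip, which pays for the at most one new vertex ranked above it. Restricting the count to
  fired vertices makes the bound an invariant from the empty sequence on.
\<close>

lemma last_firing_bound:
  assumes "legal_seq n T c is"
  shows "\<exists>r. (\<forall>u\<in>set is. r u < length is) \<and>
    (\<forall>v\<in>set is. int (card {u \<in> nbrs T v \<inter> set is. r v \<le> r u}) \<le> fire_seq n T c is $ v)"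
  using assms
proof (induction "is" rule: rev_induct)
  case Nil
  then show ?case by simp
next
  case (snoc i "is")
  define d where "d = fire_seq n T c is"
  from snoc.prems have leg: "legal_seq n T c is" "legal_fire n T d i"
    by (auto simp: legal_seq_append d_def)
  then have i: "i < n" by (simp add: legal_fire_def)
  from snoc.IH[OF leg(1)] obtain r where r1: "\<forall>u\<in>set is. r u < length is"
    and r2: "\<And>v. v \<in> set is \<Longrightarrow> int (card {u \<in> nbrs T v \<inter> set is. r v \<le> r u}) \<le> d $ v"
    unfolding d_def by blast
  define r' where "r' = r(i := length is)"
  have "int (card {u \<in> nbrs T v \<inter> set (is @ [i]). r' v \<le> r' u}) \<le> fire n T d i $ v"
    if v: "v \<in> set (is @ [i])" for v
  proof (cases "v = i")
    case True
    have "r' u < r' v" if "u \<in> nbrs T v" "u \<in> set (is @ [i])" for u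
      using that True r1 by (auto simp: r'_def)
    then have empty: "{u \<in> nbrs T v \<inter> set (is @ [i]). r' v \<le> r' u} = {}"
      by (auto simp: not_le[symmetric] simp del: set_append)
    show ?thesis
      unfolding empty using True i leg(2) by (simp add: fire_index legal_fire_def deg_eq)
  next
    case False
    with v have vs: "v \<in> set is" by simp
    with leg(1) have vn: "v < n" using legal_seq_imp_set by fastforce
    show ?thesis
    proof (cases "v \<in> nbrs T i")
      case True
      have "{u \<in> nbrs T v \<inter> set (is @ [i]). r' v \<le> r' u} \<subseteq>
            insert i {u \<in> nbrs T v \<inter> set is. r v \<le> r u}"
        using False by (auto simp: r'_def split: if_splits)
      then have "card {u \<in> nbrs T v \<inter> set (is @ [i]). r' v \<le> r' u} \<le>
            card (insert i {u \<in> nbrs T v \<inter> set is. r v \<le> r u})"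
        by (intro card_mono) auto
      also have "\<dots> \<le> Suc (card {u \<in> nbrs T v \<inter> set is. r v \<le> r u})"
        by (rule card_insert_le_m1) auto
      finally show ?thesis
        using r2[OF vs] True False i vn by (simp add: fire_index del: set_append)
    next
      case nonadjacent: False
      have "{u \<in> nbrs T v \<inter> set (is @ [i]). r' v \<le> r' u} \<subseteq>
            {u \<in> nbrs T v \<inter> set is. r v \<le> r u}"
        using False nonadjacent nbrs_sym[of v i] by (auto simp: r'_def split: if_splits)
      then have "card {u \<in> nbrs T v \<inter> set (is @ [i]). r' v \<le> r' u} \<le>
            card {u \<in> nbrs T v \<inter> set is. r v \<le> r u}"
        by (intro card_mono) auto
      then show ?thesis
        using r2[OF vs] nonadjacent False i vn by (simp add: fire_index del: set_append)
    qed
  qed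
  moreover have "\<forall>u\<in>set (is @ [i]). r' u < length (is @ [i])"
    using r1 by (auto simp: r'_def less_SucI)
  ultimately show ?case
    by (intro exI[of _ r']) (simp add: fire_seq_append d_def)
qed

lemma firing_rank_if_all_fire:
  assumes "legal_seq n T c is" "{0..<n} \<subseteq> set is"
  shows "\<exists>r. firing_rank (fire_seq n T c is) r"
proof -
  obtain r :: "nat \<Rightarrow> nat" where r: "\<forall>v\<in>set is. int (card {u \<in> nbrs T v \<inter> set is. r v \<le> r u}) \<le>
      fire_seq n T c is $ v"
    using last_firing_bound[OF assms(1)] by blast
  have "nbrs T v \<inter> set is = nbrs T v" for v
    using nbrs_subset assms(2) by blast
  with r assms(2) show ?thesis
    unfolding firing_rank_def by (intro exI[of _ r]) (auto simp: subset_iff)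
qed

text \<open>
  A vertex \<open>v\<close> of least rank in the set \<open>A\<close> where \<open>x\<close> is maximal can fire: the rank of \<open>c\<close> gives
  \<open>c $ v\<close> at least as large as the number of neighbours in \<open>A\<close>, and each neighbour outside \<open>A\<close>
  contributes at least 1 to the surplus of \<open>s $ v\<close> over \<open>c $ v\<close>. Firing \<open>v\<close> decreases \<open>x v\<close> by one.
\<close>

lemma legal_seq_to_ranked:
  fixes x :: "nat \<Rightarrow> nat"
  assumes "firing_rank c r" "dim_vec c = n" "dim_vec s = n"
    and "\<And>i. i < n \<Longrightarrow> s $ i = c $ i + lap T (\<lambda>j. int (x j)) i"
  shows "\<exists>is. length is = (\<Sum>i<n. x i) \<and> legal_seq n T s is \<and> fire_seq n T s is = c"
  using assms(3,4)
proof (induction "\<Sum>i<n. x i" arbitrary: x s)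
  case 0
  have x0: "x i = 0" if "i < n" for i
    using 0(1) that by simp
  have "lap T (\<lambda>j. int (x j)) i = 0" if "i < n" for i
    unfolding lap_def using nbrs_subset[of i] that by (intro sum.neutral) (auto simp: x0)
  with 0 assms(2) have "s = c"
    by (intro eq_vecI) auto
  with 0(1) show ?case by (intro exI[of _ "[]"]) simp
next
  case (Suc k)
  define M where "M = Max (x ` {..<n})"
  define A where "A = {v. v < n \<and> x v = M}"
  have "M \<in> x ` {..<n}" unfolding M_def using n_pos by (intro Max_in) auto
  then have "A \<noteq> {}" by (auto simp: A_def)
  have max: "x i \<le> M" if "i < n" for i
    unfolding M_def using that by simp
  obtain v where v: "v \<in> A" "\<And>u. u \<in> A \<Longrightarrow> r v \<le> r u"
    using \<open>A \<noteq> {}\<close> ex_has_least_nat[of "\<lambda>v. v \<in> A" _ r] by blast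
  then have vn: "v < n" and xv: "x v = M" by (auto simp: A_def)
  have "M > 0"
  proof (rule ccontr)
    assume "\<not> M > 0"
    with max have "(\<Sum>i<n. x i) = 0" by simp
    with Suc(2) show False by simp
  qed
  have out: "(if u \<in> A then 0 else 1) \<le> int (x v) - int (x u)" if "u \<in> nbrs T v" for u
    using that nbrs_subset[of v] max[of u] xv by (force simp: A_def)
  have "int (card (nbrs T v - A)) = (\<Sum>u\<in>nbrs T v. if u \<in> A then 0 else 1)"
    by (simp add: sum.If_cases Diff_eq)
  also have "\<dots> \<le> lap T (\<lambda>j. int (x j)) v"
    unfolding lap_def by (intro sum_mono out)
  finally have outer: "int (card (nbrs T v - A)) \<le> lap T (\<lambda>j. int (x j)) v" .
  have "card (nbrs T v \<inter> A) \<le> card {u \<in> nbrs T v. r v \<le> r u}"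
    using v by (intro card_mono) auto
  with assms(1) vn have inner: "int (card (nbrs T v \<inter> A)) \<le> c $ v"
    unfolding firing_rank_def by force
  have "card (nbrs T v) = card (nbrs T v \<inter> A) + card (nbrs T v - A)"
    using card_Un_disjoint[of "nbrs T v \<inter> A" "nbrs T v - A"]
    by (simp add: Int_Diff_Un) (simp add: Int_Diff_disjoint)
  with inner outer Suc.prems(2)[OF vn] have leg: "legal_fire n T s v"
    using vn by (simp add: legal_fire_def deg_eq)
  define y where "y = x(v := x v - 1)"
  have xy: "int (x j) = int (y j) + (if j = v then 1 else 0)" for j
    using \<open>M > 0\<close> xv by (simp add: y_def)
  \<comment> \<open>Firing \<open>v\<close> subtracts the Laplacian of the indicator function of \<open>v\<close>.\<close>
  have lap_ind: "lap T (\<lambda>j. if j = v then 1 else 0) i =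
      (if i = v then int (card (nbrs T v)) else if i \<in> nbrs T v then - 1 else 0)" for i
  proof (cases "i = v")
    case True
    have "lap T (\<lambda>j. if j = v then 1 else 0) i = (\<Sum>j\<in>nbrs T v. 1)"
      unfolding lap_def True by (intro sum.cong) auto
    then show ?thesis using True by simp
  next
    case False
    have "lap T (\<lambda>j. if j = v then 1 else 0) i = (\<Sum>j\<in>nbrs T i. if j = v then - 1 else 0)"
      unfolding lap_def using False by (intro sum.cong) auto
    then show ?thesis using False nbrs_sym[of v i] by simp
  qed
  have "fire n T s v $ i = c $ i + lap T (\<lambda>j. int (y j)) i" if "i < n" for i
    using Suc.prems(2)[OF that] lap_ind[of i] vn that
    unfolding xy by (simp add: lap_add fire_index)
  moreover have sum_eq: "(\<Sum>i<n. x i) = Suc (\<Sum>i<n. y i)"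
  proof -
    have "int (\<Sum>i<n. x i) = int (\<Sum>i<n. y i) + 1"
      using vn by (simp add: xy sum.distrib)
    then show ?thesis by linarith
  qed
  ultimately obtain "is" where "length is = (\<Sum>i<n. y i)"
      "legal_seq n T (fire n T s v) is" "fire_seq n T (fire n T s v) is = c"
    using Suc.hyps(1)[of y "fire n T s v"] Suc.hyps(2) by auto
  with leg sum_eq show ?case
    by (intro exI[of _ "v # is"]) simp
qed

lemma fire_seq_unfired:
  assumes "legal_seq n T c is" "v < n" "v \<notin> set is"
  shows "c $ v + (if nbrs T v \<inter> set is = {} then 0 else 1) \<le> fire_seq n T c is $ v"
  using assms
proof (induction "is" arbitrary: c)
  case (Cons i "is")
  then have "i < n" by (simp add: legal_fire_def)
  with Cons.IH[of "fire n T c i"] Cons.prems nbrs_sym[of v i] show ?case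
    by (auto simp: fire_index split: if_splits)
qed simp

section \<open>Connected graphs\<close>

context
  assumes connected: "Digraph_Component.connected (with_proj T)"
begin

lemma rtrancl_arcs:
  assumes "u < n" "v < n"
  shows "(u, v) \<in> (parcs T)\<^sup>*"
proof -
  have "strongly_connected (with_proj T)"
    using connected G.pair_sym_arcs by (rule G.symmetric_connected_imp_strongly_connected[rotated])
  then have "u \<rightarrow>\<^sup>*\<^bsub>with_proj T\<^esub> v"
    using assms pverts by (auto simp: strongly_connected_def)
  then show ?thesis
    by (simp add: reachable_def rtrancl_on_rtranclI)
qed

text \<open>
  The set of fired vertices is closed under taking neighbours, because an unfired vertex with a
  fired neighbour would end with more chips than it had at the start.
\<close>

lemma all_fire_in_closed_seq:
  assumes "legal_seq n T c is" "is \<noteq> []" "fire_seq n T c is = c"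
  shows "{0..<n} \<subseteq> set is"
proof -
  have sub: "set is \<subseteq> {0..<n}"
    using assms(1) by (rule legal_seq_imp_set)
  obtain u where u: "u \<in> set is" using assms(2) by (cases "is") auto
  have "v \<in> set is" if "(u, v) \<in> (parcs T)\<^sup>*" for v
    using that
  proof induction
    case (step v w)
    then have w: "w \<in> nbrs T v" by (simp add: nbrs_def)
    then have "w < n" using nbrs_subset by fastforce
    moreover have "nbrs T w \<inter> set is \<noteq> {}"
      using step.IH w nbrs_sym[of w v] by blast
    ultimately show ?case
      using fire_seq_unfired[OF assms(1), of w] assms(3) by (cases "w \<in> set is") simp_all
  qed (rule u)
  moreover have "u < n" using u sub by auto
  ultimately show ?thesis
    using rtrancl_arcs by auto
qed

lemma self_reachable_iff_firing_rank:
  assumes "chip_config n c"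
  shows "self_reachable n T c \<longleftrightarrow> (\<exists>r. firing_rank c r)"
proof
  assume "self_reachable n T c"
  then obtain "is" where "is \<noteq> []" "legal_seq n T c is" "fire_seq n T c is = c"
    using assms by (auto simp: self_reachable_def reachable_iff)
  with firing_rank_if_all_fire[of c "is"] all_fire_in_closed_seq show "\<exists>r. firing_rank c r"
    by metis
next
  assume "\<exists>r. firing_rank c r"
  then obtain r where r: "firing_rank c r" ..
  have "dim_vec c = n" using assms by (auto simp: chip_config_def)
  with legal_seq_to_ranked[OF r, of c "\<lambda>_. 1"]
  obtain "is" where "length is = n" "legal_seq n T c is" "fire_seq n T c is = c"
    by (auto simp: lap_const)
  with n_pos assms show "self_reachable n T c"
    by (auto simp: self_reachable_def reachable_iff)
qed

text \<open>
  Prefixing a closed sequence at \<open>s\<close> ensures that every vertex fires on the way to \<open>c\<close>.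
\<close>

lemma self_reachable_if_reachable:
  assumes "self_reachable n T s" "c \<in> reachable_configs n T s"
  shows "self_reachable n T c"
proof -
  have s: "chip_config n s" using assms(1) by (simp add: self_reachable_def)
  obtain "is" where i: "is \<noteq> []" "legal_seq n T s is" "fire_seq n T s is = s"
    using assms(1) s by (auto simp: self_reachable_def reachable_iff)
  obtain js where j: "legal_seq n T s js" "fire_seq n T s js = c"
    using assms(2) s by (auto simp: reachable_iff)
  have "{0..<n} \<subseteq> set (is @ js)"
    using all_fire_in_closed_seq[OF i(2,1,3)] by auto
  moreover have "legal_seq n T s (is @ js)" "fire_seq n T s (is @ js) = c"
    using i j by (auto simp: legal_seq_append fire_seq_append)
  ultimately have "\<exists>r. firing_rank c r"
    using firing_rank_if_all_fire[of s "is @ js"] by simp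
  moreover have "chip_config n c"
    using assms(2) by (simp add: reachable_configs_def)
  ultimately show ?thesis by (simp add: self_reachable_iff_firing_rank)
qed

lemma reachable_if_lap_equivalent:
  assumes "self_reachable n T s" "self_reachable n T c"
    and "\<And>i. i < n \<Longrightarrow> s $ i = c $ i + lap T x i"
  shows "c \<in> reachable_configs n T s"
proof -
  have s: "chip_config n s" and c: "chip_config n c"
    using assms by (auto simp: self_reachable_def)
  obtain r where r: "firing_rank c r"
    using assms(2) c self_reachable_iff_firing_rank by blast
  \<comment> \<open>Constants lie in the kernel of the Laplacian, so \<open>x\<close> may be shifted to have minimum 0.\<close>
  define m where "m = Min (x ` {..<n})"
  define y where "y i = nat (x i - m)" for i
  have y: "int (y i) = x i + - m" if "i < n" for i
    using that by (simp add: y_def m_def)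
  have "lap T (\<lambda>j. int (y j)) i = lap T (\<lambda>j. x j + - m) i" if "i < n" for i
    unfolding lap_def using nbrs_subset[of i] that by (intro sum.cong) (auto simp: y)
  then have "lap T (\<lambda>j. int (y j)) i = lap T x i" if "i < n" for i
    using that by (simp only: lap_add lap_const)
  with assms(3) legal_seq_to_ranked[OF r, of s y] s c
  obtain js where j: "legal_seq n T s js" "fire_seq n T s js = c"
    by (auto simp: chip_config_def)
  obtain "is" where i: "is \<noteq> []" "legal_seq n T s is" "fire_seq n T s is = s"
    using assms(1) s by (auto simp: self_reachable_def reachable_iff)
  \<comment> \<open>For \<open>c = s\<close> the sequence \<open>js\<close> may be empty, so a closed sequence is put in front.\<close>
  show ?thesis
    unfolding reachable_iff[OF s] using i j
    by (intro exI[of _ "is @ js"]) (simp add: legal_seq_append fire_seq_append)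
qed

end

section \<open>Trees\<close>

context
  assumes tree: "undirected_tree T"
begin

lemma connected_tree: "Digraph_Component.connected (with_proj T)"
  using tree by (simp add: undirected_tree_def)

text \<open>
  A path from \<open>u\<close> to \<open>v\<close> that avoids the edge has length at least 2, and the arc back from \<open>v\<close> to \<open>u\<close>
  closes it to a cycle of length at least 3.
\<close>

lemma edge_is_bridge:
  assumes uv: "(u, v) \<in> parcs T"
  shows "(u, v) \<notin> (parcs T - {(u, v), (v, u)})\<^sup>*"
proof
  assume path: "(u, v) \<in> (parcs T - {(u, v), (v, u)})\<^sup>*"
  define H where "H = \<lparr>pverts = pverts T, parcs = parcs T - {(u, v), (v, u)}\<rparr>"
  have "pair_wf_digraph H"
    by (rule pair_wf_digraph.intro) (auto simp: H_def dest: G.in_arcsD1 G.in_arcsD2)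
  then interpret H: pair_wf_digraph H .
  have "u \<noteq> v" using G.pair_no_loops[OF uv] by simp
  have "(u, v) \<in> (parcs H)\<^sup>*" using path by (simp add: H_def)
  then have "u \<rightarrow>\<^sup>*\<^bsub>with_proj H\<^esub> v"
    using G.in_arcsD1[OF uv] by (subst H.reachable_conv') (simp_all add: H_def)
  then obtain p where "H.apath u p v"
    by (auto simp: H.reachable_apath)
  then have p: "set p \<subseteq> parcs H" "pcas u p v" "distinct (pawalk_verts u p)"
    by (auto simp: H.apath_def H.awalk_def)
  have "2 \<le> length p"
  proof (rule ccontr)
    assume "\<not> 2 \<le> length p"
    then consider "p = []" | e where "p = [e]"
      by (cases p; cases "tl p") auto
    then show False
      using p \<open>u \<noteq> v\<close> by cases (auto simp: H_def)
  qed
  have close: "pawalk_verts a (q @ [(b, w)]) = pawalk_verts a q @ [w]" "pcas a (q @ [(b, w)]) w"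
    if "pcas a q b" for a b w q
    using that by (induction q arbitrary: a) auto
  have vu: "(v, u) \<in> parcs T"
    using uv nbrs_sym[of u v] by (auto simp: nbrs_def)
  have "distinct (tl (pawalk_verts u (p @ [(v, u)])))"
    using p(2,3) unfolding close(1)[OF p(2)] by (cases p) auto
  moreover have "G.awalk u (p @ [(v, u)]) u"
  proof -
    have "set p \<subseteq> parcs T" using p(1) by (auto simp: H_def)
    then show ?thesis
      unfolding G.awalk_def using close(2)[OF p(2)] vu G.in_arcsD1[OF uv] by simp
  qed
  ultimately have "G.cycle (p @ [(v, u)])"
    unfolding G.cycle_def by blast
  with tree \<open>2 \<le> length p\<close> show False
    by (auto simp: undirected_tree_def)
qed

text \<open>
  The preimage is the indicator function of the component of \<open>u\<close> after deletion of the edge: the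
  only edge between this component and the other vertices is \<open>uv\<close>.
\<close>

lemma lap_edge:
  assumes uv: "(u, v) \<in> parcs T"
  shows "\<exists>x. \<forall>i. lap T x i = (if i = u then 1 else 0) - (if i = v then 1 else 0)"
proof -
  define R where "R = parcs T - {(u, v), (v, u)}"
  define x :: "nat \<Rightarrow> int" where "x w = (if (u, w) \<in> R\<^sup>* then 1 else 0)" for w
  have xu: "x u = 1" and xv: "x v = 0"
    using edge_is_bridge[OF uv] by (auto simp: x_def R_def)
  have x_eq: "x i = x j" if "(i, j) \<in> R" for i j
  proof -
    have "(j, i) \<in> R" using that nbrs_sym[of i j] by (auto simp: R_def nbrs_def)
    with that have "(u, i) \<in> R\<^sup>* \<longleftrightarrow> (u, j) \<in> R\<^sup>*"
      by (blast intro: rtrancl_into_rtrancl)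
    then show ?thesis by (simp add: x_def)
  qed
  have "v \<in> nbrs T u" using uv by (simp add: nbrs_def)
  moreover from this have "u \<in> nbrs T v" using nbrs_sym by blast
  moreover have "u \<noteq> v" using G.pair_no_loops[OF uv] by simp
  ultimately have vu: "u \<noteq> v" "v \<in> nbrs T u" "u \<in> nbrs T v" by blast+
  have diff: "x i - x j = (if i = u \<and> j = v then 1 else 0) - (if i = v \<and> j = u then 1 else 0)"
    if "j \<in> nbrs T i" for i j
  proof (cases "(i, j) \<in> R")
    case True
    then have "\<not> (i = u \<and> j = v)" "\<not> (i = v \<and> j = u)" unfolding R_def by blast+
    then show ?thesis by (simp only: x_eq[OF True] if_False diff_self)
  next
    case False
    with that consider "i = u" "j = v" | "i = v" "j = u" unfolding R_def nbrs_def by blast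
    then show ?thesis using xu xv vu(1) by cases simp_all
  qed
  have "lap T x i = (if i = u then 1 else 0) - (if i = v then 1 else 0)" for i
  proof -
    have "lap T x i = (\<Sum>j\<in>nbrs T i. (if i = u \<and> j = v then 1 else 0)
        - (if i = v \<and> j = u then 1 else 0))"
      unfolding lap_def by (intro sum.cong refl diff)
    then show ?thesis
      using vu by (cases "i = u"; cases "i = v") (auto simp: sum_subtractf sum_negf)
  qed
  then show ?thesis by blast
qed

lemma lap_pair:
  assumes "u < n" "v < n"
  shows "\<exists>x. \<forall>i. lap T x i = (if i = u then 1 else 0) - (if i = v then 1 else 0)"
  using rtrancl_arcs[OF connected_tree assms]
proof induction
  case base
  show ?case by (intro exI[of _ "\<lambda>_. 0"]) (simp add: lap_const)
next
  case (step v w)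
  then obtain x where x: "\<And>i. lap T x i = (if i = u then 1 else 0) - (if i = v then 1 else 0)"
    by blast
  obtain y where y: "\<And>i. lap T y i = (if i = v then 1 else 0) - (if i = w then 1 else 0)"
    using lap_edge[OF step(2)] by blast
  show ?case
    by (intro exI[of _ "\<lambda>i. x i + y i"]) (simp add: lap_add x y)
qed

text \<open>
  With \<open>e k\<close> the unit vectors, a vector \<open>d\<close> with sum 0 is the sum of \<open>d k * (e k - e 0)\<close> over all
  \<open>k\<close>, since the subtracted multiples of \<open>e 0\<close> add up to 0.
\<close>

lemma lap_surj_sum_zero:
  assumes "(\<Sum>i<n. d i) = 0"
  shows "\<exists>x. \<forall>i<n. lap T x i = d i"
proof -
  have "\<forall>k\<in>{..<n}. \<exists>x. \<forall>i. lap T x i = (if i = k then 1 else 0) - (if i = 0 then 1 else 0)"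
    using lap_pair n_pos by simp
  from bchoice[OF this] obtain x where x:
    "\<And>k i. k < n \<Longrightarrow> lap T (x k) i = (if i = k then 1 else 0) - (if i = 0 then 1 else 0)"
    by auto
  define z where "z i = (\<Sum>k<n. d k * x k i)" for i
  have "lap T z i = d i" if "i < n" for i
  proof -
    have "lap T z i = (\<Sum>k<n. d k * lap T (x k) i)"
      unfolding z_def lap_sum lap_scale ..
    also have "\<dots> = (\<Sum>k<n. (if i = k then d k else 0) - d k * (if i = 0 then 1 else 0))"
      by (intro sum.cong) (auto simp: x)
    also have "\<dots> = (\<Sum>k<n. if i = k then d k else 0)
        - (\<Sum>k<n. d k) * (if i = 0 then 1 else 0)"
      by (simp add: sum_subtractf sum_distrib_right)
    also have "\<dots> = d i"
      using that assms by simp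
    finally show ?thesis .
  qed
  then show ?thesis by blast
qed

end

end

theorem theorem4p2:
  fixes n :: nat and T :: "nat pair_pre_digraph" and s c :: "int vec"
  assumes "vertex_tree n T"
    and "chip_config n s"
    and "self_reachable n T s"
    and "chip_config n c"
    and "(\<Sum>i<n. c $ i) = (\<Sum>i<n. s $ i)"
  shows "c \<in> reachable_configs n T s \<longleftrightarrow> self_reachable n T c"
proof -
  interpret chip_graph n T
    using assms(1) by unfold_locales (simp add: vertex_tree_def)
  have tree: "undirected_tree T" using assms(1) by (simp add: vertex_tree_def)
  note conn = connected_tree[OF tree]
  obtain x where "\<forall>i<n. lap T x i = s $ i - c $ i"
    using lap_surj_sum_zero[OF tree, of "\<lambda>i. s $ i - c $ i"] assms(5)
    by (auto simp: sum_subtractf)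
  then show ?thesis
    using self_reachable_if_reachable[OF conn assms(3)]
      reachable_if_lap_equivalent[OF conn assms(3), of c x] by auto
qed

end
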